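(* The generating function $R(x)=\sum_{n\geq 0}|I_n(102,021)|\,x^{n+1}$ is given by $$R(x)=\frac{1-\sqrt{1-4x}}{2x(1-x)}+\frac{(2x^2-2x+1)(x^3-2x^2+3x-1)}{(1-x)^4(1-2x)}.$$ Moreover, for all $n\ge 1$, $$|I_{n-1}(102,021)|=\sum_{k=0}^n\frac{1}{k+1}\binom{2k}{k}-1-\frac16 n^3-\frac{11}{6}n+2^n.$$
   Context: For $n\ge 0$, $I_n$ denotes the set of inversion sequences $e=e_0e_1\cdots e_n$, i.e. integer sequences with $0\le e_i\le i$ for each $0\le i\le n$ (so elements of $I_n$ have $n+1$ letters). An inversion sequence contains a pattern (word) $\tau$ of length $k$ if it has a subsequence (not necessarily consecutive) of length $k$ that is order isomorphic to $\tau$ (same relative order, including equalities); otherwise it avoids $\tau$. $I_n(\tau_1,\dots,\tau_m)$ is the set of $e\in I_n$ avoiding all of $\tau_1,\dots,\tau_m$. Generating functions are formal power series in $x$ (with $\sqrt{\cdot}$ having constant term $1$). *)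

theory Defs
  imports
    "HOL-Computational_Algebra.Formal_Power_Series"
    "HOL-Library.Sublist"
begin

definition inversion_sequences :: "nat \<Rightarrow> nat list set" where
  "inversion_sequences n = {e. length e = Suc n \<and> (\<forall>i\<le>n. e ! i \<le> i)}"

text \<open>The condition on strict comparisons for all ordered pairs of positions also
  forces equal letters to correspond to equal letters.\<close>

definition order_isomorphic :: "nat list \<Rightarrow> nat list \<Rightarrow> bool" where
  "order_isomorphic u v \<longleftrightarrow> length u = length v \<and>
     (\<forall>i<length u. \<forall>j<length u. u ! i < u ! j \<longleftrightarrow> v ! i < v ! j)"

definition contains_pattern :: "nat list \<Rightarrow> nat list \<Rightarrow> bool" where
  "contains_pattern e p \<longleftrightarrow> (\<exists>u. subseq u e \<and> order_isomorphic u p)"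

definition avoiding_inversion_sequences :: "nat \<Rightarrow> nat list set \<Rightarrow> nat list set" where
  "avoiding_inversion_sequences n P =
     {e \<in> inversion_sequences n. \<forall>p\<in>P. \<not> contains_pattern e p}"

text \<open>The leading factor \<^term>\<open>fps_X\<close> accounts for the exponent \<open>n + 1\<close>:
  a sequence indexed by \<open>n\<close> has \<open>n + 1\<close> letters.\<close>

definition R :: "real fps" where
  "R = fps_X * Abs_fps (\<lambda>n. real (card (avoiding_inversion_sequences n {[1,0,2], [0,2,1]})))"

text \<open>The square root with constant term 1, since \<^term>\<open>root 2 1 = (1::real)\<close>.\<close>

definition sqrt_1_minus_4x :: "real fps" where
  "sqrt_1_minus_4x = fps_radical root 2 (1 - 4 * fps_X)"

end

theory Submission
  imports Defs
begin

text \<open>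
  In a nonempty inversion sequence the first letter is \<open>0\<close>. Hence a sequence avoiding \<open>021\<close>
  has weakly increasing nonzero letters. If moreover it avoids \<open>102\<close> and some \<open>0\<close> stands between
  two nonzero letters, then every nonzero letter before this \<open>0\<close> is at least, and hence equal to,
  every nonzero letter after it, so that all nonzero letters are equal.

  Looking at the last letter, an avoider of length \<open>n + 1\<close> with \<open>n > 0\<close> is therefore of exactly
  one of three kinds (\<open>avoiders_Suc\<close>):

  \<^item> an arbitrary avoider of length \<open>n\<close> followed by \<open>0\<close>;

  \<^item> a weakly increasing inversion sequence of length \<open>n + 1\<close> other than the zero sequence; there
    are \<open>C(n + 1) - 1\<close> of these, with \<open>C\<close> the Catalan numbers (\<open>card_sorted\<close>, proved by
    counting with ballot numbers);

  \<^item> an inversion sequence of length \<open>n\<close> that is not weakly increasing and has letters in \<open>{0, m}\<close>,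
    followed by \<open>m\<close>; there are \<open>2 ^ n - 1 - n * (n + 1) / 2\<close> of these
    (\<open>card_unsorted_two_valued\<close>).

  Summation gives the explicit formula (\<open>card_avoiders\<close>). For the generating function, the partial
  sums of the Catalan numbers account for the summand with the square root (\<open>catalan_part\<close>), and
  the remaining terms for the rational summand (\<open>rational_part\<close>). The explicit formula gives \<open>1\<close>
  at \<open>n = 0\<close>, whereas the constant term of the series is \<open>0\<close>; this is why \<open>1\<close> is subtracted in
  \<open>rational_part\<close>.
\<close>

unbundle fps_syntax

section \<open>Lists below the diagonal\<close>

text \<open>The inversion sequences with \<open>n\<close> letters. Indexing by the length, rather than by the last
  position, also admits the empty sequence.\<close>

definition below_diagonal :: "nat \<Rightarrow> nat list set" where
  "below_diagonal n = {e. length e = n \<and> (\<forall>i<n. e ! i \<le> i)}"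

lemma inversion_sequences_eq: "inversion_sequences n = below_diagonal (Suc n)"
  by (auto simp: inversion_sequences_def below_diagonal_def less_Suc_eq_le)

lemma snoc_in_below_diagonal_iff:
  "e @ [y] \<in> below_diagonal (Suc n) \<longleftrightarrow> e \<in> below_diagonal n \<and> y \<le> n"
  by (auto simp: below_diagonal_def nth_append less_Suc_eq)

lemma below_diagonal_SucE:
  assumes "f \<in> below_diagonal (Suc n)"
  obtains e y where "f = e @ [y]" "e \<in> below_diagonal n" "y \<le> n"
proof -
  have "f \<noteq> []" using assms by (auto simp: below_diagonal_def)
  then have "f = butlast f @ [last f]" by simp
  with assms that show thesis by (metis snoc_in_below_diagonal_iff)
qed

lemma below_diagonal_0 [simp]: "below_diagonal 0 = {[]}"
  by (auto simp: below_diagonal_def)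

lemma below_diagonal_set_less:
  assumes "e \<in> below_diagonal n" "x \<in> set e"
  shows "x < n"
  using assms by (fastforce simp: below_diagonal_def in_set_conv_nth)

lemma below_diagonal_hd:
  assumes "e \<in> below_diagonal n" "n > 0"
  shows "e ! 0 = 0"
  using assms by (auto simp: below_diagonal_def)

lemma finite_below_diagonal: "finite (below_diagonal n)"
proof (rule finite_subset)
  show "below_diagonal n \<subseteq> {e. set e \<subseteq> {..<n} \<and> length e = n}"
    using below_diagonal_set_less by (auto simp: below_diagonal_def)
qed (rule finite_lists_length_eq, simp)

lemma zeros_in_below_diagonal: "replicate n 0 \<in> below_diagonal n"
  by (simp add: below_diagonal_def)

lemma eq_zeros_iff:
  assumes "e \<in> below_diagonal n"
  shows "e = replicate n 0 \<longleftrightarrow> set e \<subseteq> {0}"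
proof
  assume "e = replicate n 0"
  then show "set e \<subseteq> {0}" by auto
next
  assume "set e \<subseteq> {0}"
  then show "e = replicate n 0"
    using assms by (intro replicate_eqI) (auto simp: below_diagonal_def)
qed

lemma inj_on_snoc: "inj_on (\<lambda>e. e @ [f e]) A"
  by (auto simp: inj_on_def)

lemma Int_image_empty: "(\<And>x. x \<in> U \<Longrightarrow> g x \<notin> X) \<Longrightarrow> X \<inter> g ` U = {}"
  by blast

section \<open>Weakly increasing sequences and Catalan numbers\<close>

text \<open>The weakly increasing inversion sequences with \<open>n\<close> letters, all of them at most \<open>m\<close>.
  For \<open>m \<le> n\<close> they correspond to the lattice paths counted by the ballot numbers.\<close>

definition sorted_bounded :: "nat \<Rightarrow> nat \<Rightarrow> nat list set" where
  "sorted_bounded n m = {e \<in> below_diagonal n. sorted e \<and> set e \<subseteq> {..m}}"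

lemma finite_sorted_bounded: "finite (sorted_bounded n m)"
  by (rule finite_subset[OF _ finite_below_diagonal]) (auto simp: sorted_bounded_def)

lemma sorted_bounded_0 [simp]: "sorted_bounded n 0 = {replicate n 0}"
  using zeros_in_below_diagonal
  by (auto simp: sorted_bounded_def eq_zeros_iff)

lemma sorted_bounded_top: "sorted_bounded (Suc n) (Suc n) = sorted_bounded (Suc n) n"
  by (auto simp: sorted_bounded_def dest: below_diagonal_set_less)

text \<open>The two parts are distinguished by whether the last, hence largest, letter is \<open>m + 1\<close>.\<close>

lemma sorted_bounded_Suc_Suc:
  assumes "m < n"
  shows "sorted_bounded (Suc n) (Suc m) =
    sorted_bounded (Suc n) m \<union> (\<lambda>e. e @ [Suc m]) ` sorted_bounded n (Suc m)"
proof (intro equalityI subsetI)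
  fix f assume f: "f \<in> sorted_bounded (Suc n) (Suc m)"
  then obtain e y where fe: "f = e @ [y]" "e \<in> below_diagonal n" "y \<le> n"
    by (auto simp: sorted_bounded_def elim: below_diagonal_SucE)
  with f have e: "e \<in> sorted_bounded n (Suc m)" "y \<le> Suc m" "\<forall>x\<in>set e. x \<le> y"
    by (auto simp: sorted_bounded_def sorted_append)
  show "f \<in> sorted_bounded (Suc n) m \<union> (\<lambda>e. e @ [Suc m]) ` sorted_bounded n (Suc m)"
  proof (cases "y = Suc m")
    case False
    with e(2) have "y \<le> m" by simp
    with e(3) f fe have "f \<in> sorted_bounded (Suc n) m"
      by (auto simp: sorted_bounded_def intro: order_trans)
    then show ?thesis by simp
  qed (use fe e in auto)
next
  fix f assume "f \<in> sorted_bounded (Suc n) m \<union> (\<lambda>e. e @ [Suc m]) ` sorted_bounded n (Suc m)"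
  then show "f \<in> sorted_bounded (Suc n) (Suc m)"
    using assms by (auto simp: sorted_bounded_def snoc_in_below_diagonal_iff sorted_append)
qed

lemma card_sorted_bounded_Suc_Suc:
  assumes "m < n"
  shows "card (sorted_bounded (Suc n) (Suc m)) =
    card (sorted_bounded (Suc n) m) + card (sorted_bounded n (Suc m))"
  unfolding sorted_bounded_Suc_Suc[OF assms]
  by (subst card_Un_disjoint)
    (auto simp: finite_sorted_bounded card_image inj_on_snoc sorted_bounded_def
       intro: finite_subset[OF _ finite_below_diagonal])

text \<open>Ballot numbers as differences of binomial coefficients. The case distinction makes
  \<open>(n + m) choose (- 1)\<close> equal to \<open>0\<close>; integers avoid truncated subtraction.\<close>

definition ballot :: "nat \<Rightarrow> nat \<Rightarrow> int" where
  "ballot n m = int ((n + m) choose m) - (if m = 0 then 0 else int ((n + m) choose (m - 1)))"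

lemma ballot_Suc_Suc: "ballot (Suc n) (Suc m) = ballot (Suc n) m + ballot n (Suc m)"
  by (cases m) (simp_all add: ballot_def)

text \<open>Because of this value, the recurrence \<open>ballot_Suc_Suc\<close> also describes the case \<open>m = n\<close>,
  where \<open>card_sorted_bounded_Suc_Suc\<close> is replaced by \<open>sorted_bounded_top\<close>.\<close>

lemma ballot_above_diagonal: "ballot n (Suc n) = 0"
proof -
  have "(n + Suc n) choose n = (n + Suc n) choose Suc n"
    using binomial_symmetric[of n "n + Suc n"] by simp
  then show ?thesis by (simp add: ballot_def)
qed

lemma card_sorted_bounded: "m \<le> n \<Longrightarrow> int (card (sorted_bounded n m)) = ballot n m"
proof (induction n arbitrary: m)
  case 0
  then show ?case by (simp add: ballot_def)
next
  case (Suc n)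
  from Suc.prems show ?case
  proof (induction m)
    case 0
    then show ?case by (simp add: ballot_def)
  next
    case (Suc m)
    show ?case
    proof (cases "m < n")
      case True
      then show ?thesis
        using Suc.IH Suc.prems \<open>\<And>m. m \<le> n \<Longrightarrow> int (card (sorted_bounded n m)) = ballot n m\<close>
        by (simp add: card_sorted_bounded_Suc_Suc ballot_Suc_Suc)
    next
      case False
      with Suc.prems have "m = n" by simp
      then show ?thesis
        using Suc.IH by (simp add: sorted_bounded_top ballot_Suc_Suc ballot_above_diagonal)
    qed
  qed
qed

text \<open>The Catalan numbers, as reals.\<close>

definition catalan :: "nat \<Rightarrow> real" where
  "catalan k = 1 / (real k + 1) * real ((2 * k) choose k)"

lemma catalan_Suc: "(real n + 2) * catalan (Suc n) = 2 * (2 * real n + 1) * catalan n"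
proof -
  have "Suc n * ((2 * Suc n) choose Suc n) = 2 * Suc n * (Suc (2 * n) choose n)"
    using Suc_times_binomial_eq[of "Suc (2 * n)" n] by simp
  then have 1: "(2 * Suc n) choose Suc n = 2 * (Suc (2 * n) choose n)"
    by (simp only: mult.assoc mult.left_commute[of 2] nat_mult_eq_cancel_disj) simp
  have "Suc (2 * n) choose n = Suc (2 * n) choose Suc n"
    using binomial_symmetric[of n "Suc (2 * n)"] by simp
  moreover have "Suc n * (Suc (2 * n) choose Suc n) = Suc (2 * n) * ((2 * n) choose n)"
    using Suc_times_binomial_eq[of "2 * n" n] by simp
  ultimately have 2: "Suc n * (Suc (2 * n) choose n) = Suc (2 * n) * ((2 * n) choose n)"
    by simp
  have "(real n + 1) * real ((2 * Suc n) choose Suc n) = 2 * real (Suc n * (Suc (2 * n) choose n))"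
    unfolding 1 by (simp add: field_simps)
  also have "\<dots> = 2 * (2 * real n + 1) * real ((2 * n) choose n)"
    unfolding 2 by (simp add: algebra_simps)
  finally have 3: "(real n + 1) * real ((2 * Suc n) choose Suc n) =
     2 * (2 * real n + 1) * real ((2 * n) choose n)" .
  have "(real n + 2) * catalan (Suc n) = real ((2 * Suc n) choose Suc n)"
    unfolding catalan_def by (simp add: field_simps)
  also have "\<dots> = 2 * (2 * real n + 1) * catalan n"
    using 3 unfolding catalan_def by (simp add: field_simps del: binomial_Suc_Suc)
  finally show ?thesis .
qed

lemma ballot_diagonal: "real_of_int (ballot n n) = catalan n"
proof (cases n)
  case (Suc m)
  have "Suc (Suc m) * ((2 * n) choose Suc (Suc m)) = Suc m * ((2 * n) choose Suc m)"
    using binomial_absorb_comp[of "2 * n" "Suc m"] binomial_absorption[of "Suc m" "2 * n"]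
    by (simp add: Suc)
  moreover have "(2 * n) choose Suc (Suc m) = (2 * n) choose m"
    using binomial_symmetric[of m "2 * n"] by (simp add: Suc)
  ultimately have "(n + 1) * ((2 * n) choose (n - 1)) = n * ((2 * n) choose n)"
    by (simp add: Suc)
  then have "real ((n + 1) * ((2 * n) choose (n - 1))) = real (n * ((2 * n) choose n))"
    by simp
  then show ?thesis
    by (simp add: ballot_def catalan_def Suc field_simps mult_2[symmetric] del: binomial_Suc_Suc)
qed (simp add: ballot_def catalan_def)

lemma card_sorted:
  "real (card {e \<in> below_diagonal n. sorted e}) = catalan n"
proof -
  have "{e \<in> below_diagonal n. sorted e} = sorted_bounded n n"
    by (auto simp: sorted_bounded_def dest: below_diagonal_set_less)
  then show ?thesis
    using card_sorted_bounded[of n n] ballot_diagonal[of n] by (metis le_refl of_int_of_nat_eq)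
qed

section \<open>Sequences with a single nonzero value\<close>

text \<open>The inversion sequences with exactly one nonzero value, split according to whether
  they are weakly increasing. A sequence with letters in \<open>{0, m}\<close> that is not weakly increasing
  automatically has a nonzero letter. In both cases the nonzero value is the maximum of the
  letters.\<close>

definition sorted_two_valued :: "nat \<Rightarrow> nat list set" where
  "sorted_two_valued n =
     {e \<in> below_diagonal n. sorted e \<and> \<not> set e \<subseteq> {0} \<and> (\<exists>m. set e \<subseteq> {0, m})}"

definition unsorted_two_valued :: "nat \<Rightarrow> nat list set" where
  "unsorted_two_valued n = {e \<in> below_diagonal n. \<not> sorted e \<and> (\<exists>m. set e \<subseteq> {0, m})}"

lemma finite_sorted_two_valued: "finite (sorted_two_valued n)"
  and finite_unsorted_two_valued: "finite (unsorted_two_valued n)"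
  by (auto simp: sorted_two_valued_def unsorted_two_valued_def finite_below_diagonal)

lemma two_valued_Max:
  fixes e :: "nat list"
  assumes "set e \<subseteq> {0, m}" "\<not> set e \<subseteq> {0}"
  shows "Max (set e) = m" "m > 0" "m \<in> set e"
proof -
  show "m \<in> set e" using assms by auto
  show "m > 0" using assms by (cases m) auto
  then show "Max (set e) = m" using assms by (intro Max_eqI) auto
qed

lemma unsorted_not_zeros: "\<not> sorted (e :: nat list) \<Longrightarrow> \<not> set e \<subseteq> {0}"
  by (metis replicate_eqI sorted_replicate singletonD subsetD)

lemma sorted_two_valued_Suc:
  "sorted_two_valued (Suc n) =
    (\<lambda>e. e @ [Max (set e)]) ` sorted_two_valued n \<union> (\<lambda>y. replicate n 0 @ [y]) ` {1..n}"
proof (intro equalityI subsetI)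
  fix f assume f: "f \<in> sorted_two_valued (Suc n)"
  then obtain e y where fe: "f = e @ [y]" "e \<in> below_diagonal n" "y \<le> n"
    by (auto simp: sorted_two_valued_def elim: below_diagonal_SucE)
  from f obtain m where m: "set f \<subseteq> {0, m}" by (auto simp: sorted_two_valued_def)
  have nz: "\<not> set f \<subseteq> {0}" using f by (auto simp: sorted_two_valued_def)
  have s: "sorted e" "\<forall>x\<in>set e. x \<le> y"
    using f fe by (auto simp: sorted_two_valued_def sorted_append)
  have y: "y = m" "m > 0" using m nz s fe by auto
  show "f \<in> (\<lambda>e. e @ [Max (set e)]) ` sorted_two_valued n \<union> (\<lambda>y. replicate n 0 @ [y]) ` {1..n}"
  proof (cases "set e \<subseteq> {0}")
    case True
    then have "e = replicate n 0" using fe eq_zeros_iff by blast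
    then show ?thesis using fe y by auto
  next
    case False
    then have "e \<in> sorted_two_valued n"
      using fe m s False by (auto simp: sorted_two_valued_def)
    moreover have "Max (set e) = y" using two_valued_Max(1)[OF _ False, of m] m fe y by auto
    ultimately show ?thesis using fe by auto
  qed
next
  fix f assume "f \<in> (\<lambda>e. e @ [Max (set e)]) ` sorted_two_valued n \<union>
    (\<lambda>y. replicate n 0 @ [y]) ` {1..n}"
  then consider e where "e \<in> sorted_two_valued n" "f = e @ [Max (set e)]"
    | y where "1 \<le> y" "y \<le> n" "f = replicate n 0 @ [y]" by auto
  then show "f \<in> sorted_two_valued (Suc n)"
  proof cases
    case (1 e)
    then obtain m where m: "set e \<subseteq> {0, m}" "\<not> set e \<subseteq> {0}" "e \<in> below_diagonal n" "sorted e"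
      by (auto simp: sorted_two_valued_def)
    note M = two_valued_Max[OF m(1,2)]
    have "m < n" using below_diagonal_set_less m(3) M(3) by blast
    with 1 M m have f: "f \<in> below_diagonal (Suc n)" "set f \<subseteq> {0, m}" "sorted f" "\<not> set f \<subseteq> {0}"
      by (auto simp: snoc_in_below_diagonal_iff sorted_append)
    then show ?thesis by (auto simp: sorted_two_valued_def)
  next
    case (2 y)
    then have f: "f \<in> below_diagonal (Suc n)" "set f \<subseteq> {0, y}" "sorted f" "\<not> set f \<subseteq> {0}"
      by (auto simp: snoc_in_below_diagonal_iff sorted_append zeros_in_below_diagonal)
    then show ?thesis by (auto simp: sorted_two_valued_def)
  qed
qed

lemma card_sorted_two_valued: "card (sorted_two_valued n) = n choose 2"
proof (induction n)
  case 0
  have "sorted_two_valued 0 = {}" by (auto simp: sorted_two_valued_def)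
  then show ?case by simp
next
  case (Suc n)
  have "card (sorted_two_valued (Suc n)) = card (sorted_two_valued n) + n"
    unfolding sorted_two_valued_Suc
    by (subst card_Un_disjoint)
      (auto simp: finite_sorted_two_valued card_image inj_on_snoc inj_on_def,
        auto simp: sorted_two_valued_def)
  also have "\<dots> = Suc n choose 2"
    using Suc by (simp add: numeral_2_eq_2)
  finally show ?case .
qed

text \<open>Removing the last letter can make the sequence weakly increasing only if that letter
  is \<open>0\<close>.\<close>

lemma unsorted_two_valued_Suc:
  "unsorted_two_valued (Suc n) =
    (\<lambda>e. e @ [0]) ` (unsorted_two_valued n \<union> sorted_two_valued n) \<union>
    (\<lambda>e. e @ [Max (set e)]) ` unsorted_two_valued n"
proof (intro equalityI subsetI)
  fix f assume f: "f \<in> unsorted_two_valued (Suc n)"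
  then obtain e y where fe: "f = e @ [y]" "e \<in> below_diagonal n" "y \<le> n"
    by (auto simp: unsorted_two_valued_def elim: below_diagonal_SucE)
  from f obtain m where m: "set f \<subseteq> {0, m}" "\<not> sorted f" by (auto simp: unsorted_two_valued_def)
  have me: "set e \<subseteq> {0, m}" using m fe by auto
  have nz: "\<not> set e \<subseteq> {0}" using m fe by (auto simp: sorted_append dest: unsorted_not_zeros)
  note M = two_valued_Max[OF me nz]
  consider "y = 0" | "y = m" "m > 0" using m fe by auto
  then show "f \<in> (\<lambda>e. e @ [0]) ` (unsorted_two_valued n \<union> sorted_two_valued n) \<union>
    (\<lambda>e. e @ [Max (set e)]) ` unsorted_two_valued n"
  proof cases
    case 1
    have "e \<in> unsorted_two_valued n \<union> sorted_two_valued n"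
      using fe me nz by (auto simp: unsorted_two_valued_def sorted_two_valued_def)
    then show ?thesis using 1 fe by blast
  next
    case 2
    have "\<not> sorted e" using m fe 2 by (auto simp: sorted_append)
    then have "e \<in> unsorted_two_valued n"
      using fe me by (auto simp: unsorted_two_valued_def)
    then show ?thesis using 2 fe M by blast
  qed
next
  fix f assume "f \<in> (\<lambda>e. e @ [0]) ` (unsorted_two_valued n \<union> sorted_two_valued n) \<union>
    (\<lambda>e. e @ [Max (set e)]) ` unsorted_two_valued n"
  then obtain e where e: "f = e @ [0] \<or> f = e @ [Max (set e)] \<and> \<not> sorted e"
    "e \<in> unsorted_two_valued n \<union> sorted_two_valued n"
    by (auto simp: unsorted_two_valued_def)
  then obtain m where m: "set e \<subseteq> {0, m}" "\<not> set e \<subseteq> {0}" "e \<in> below_diagonal n"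
    unfolding sorted_two_valued_def unsorted_two_valued_def using unsorted_not_zeros by blast
  note M = two_valued_Max[OF m(1,2)]
  have "m < n" using below_diagonal_set_less m(3) M(3) by blast
  with e m M have "f \<in> below_diagonal (Suc n)" "\<not> sorted f" "set f \<subseteq> {0, m}"
    by (auto simp: snoc_in_below_diagonal_iff sorted_append)
  then show "f \<in> unsorted_two_valued (Suc n)"
    by (auto simp: unsorted_two_valued_def)
qed

lemma card_unsorted_two_valued_Suc:
  "card (unsorted_two_valued (Suc n)) = 2 * card (unsorted_two_valued n) + (n choose 2)"
proof -
  have *: "unsorted_two_valued n \<inter> sorted_two_valued n = {}"
    by (auto simp: unsorted_two_valued_def sorted_two_valued_def)
  have "(\<lambda>e. e @ [0]) ` (unsorted_two_valued n \<union> sorted_two_valued n) \<inter>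
      (\<lambda>e. e @ [Max (set e)]) ` unsorted_two_valued n = {}"
  proof (rule Int_image_empty)
    fix e assume e: "e \<in> unsorted_two_valued n"
    have "Max (set e) \<noteq> 0"
    proof -
      from e obtain m where "set e \<subseteq> {0, m}" "\<not> set e \<subseteq> {0}"
        unfolding unsorted_two_valued_def using unsorted_not_zeros by blast
      from two_valued_Max[OF this] show ?thesis by simp
    qed
    then show "e @ [Max (set e)] \<notin>
        (\<lambda>e. e @ [0]) ` (unsorted_two_valued n \<union> sorted_two_valued n)"
      by blast
  qed
  then show ?thesis
    unfolding unsorted_two_valued_Suc
    by (simp add: card_Un_disjoint card_image inj_on_snoc finite_sorted_two_valued
        finite_unsorted_two_valued * card_sorted_two_valued)
qed

lemma real_choose_two: "real (n choose 2) = real n * (real n - 1) / 2"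
  by (induction n) (simp_all add: numeral_2_eq_2 field_simps)

lemma card_unsorted_two_valued:
  "real (card (unsorted_two_valued n)) = 2 ^ n - 1 - real n * (real n + 1) / 2"
proof (induction n)
  case 0
  have "unsorted_two_valued 0 = {}" by (auto simp: unsorted_two_valued_def)
  then show ?case by simp
next
  case (Suc n)
  have "real (card (unsorted_two_valued (Suc n))) =
      2 * real (card (unsorted_two_valued n)) + real n * (real n - 1) / 2"
    by (simp add: card_unsorted_two_valued_Suc real_choose_two)
  also have "\<dots> = 2 ^ Suc n - 1 - real (Suc n) * (real (Suc n) + 1) / 2"
    unfolding Suc.IH by (simp add: field_simps)
  finally show ?case .
qed

section \<open>Avoiders\<close>

lemma subseq_Cons_iff_nth:
  "subseq (x # xs) e \<longleftrightarrow> (\<exists>i<length e. e ! i = x \<and> subseq xs (drop (Suc i) e))"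
proof
  assume "subseq (x # xs) e"
  then obtain us vs where "e = us @ x # vs" "subseq xs vs"
    by (auto dest: list_emb_ConsD)
  then show "\<exists>i<length e. e ! i = x \<and> subseq xs (drop (Suc i) e)"
    by (intro exI[of _ "length us"]) auto
next
  assume "\<exists>i<length e. e ! i = x \<and> subseq xs (drop (Suc i) e)"
  then obtain i where i: "i < length e" "e ! i = x" "subseq xs (drop (Suc i) e)" by blast
  then have "subseq (x # xs) (take i e @ x # drop (Suc i) e)"
    by (intro list_emb_append2) simp
  with i show "subseq (x # xs) e" using id_take_nth_drop[of i e] by simp
qed

lemma subseq_3_iff_nth:
  "subseq [a, b, c] e \<longleftrightarrow>
    (\<exists>i j k. i < j \<and> j < k \<and> k < length e \<and> e ! i = a \<and> e ! j = b \<and> e ! k = c)"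
proof
  assume "subseq [a, b, c] e"
  then obtain i j k where "i < length e" "e ! i = a" "j < length e - Suc i"
    "e ! (Suc i + j) = b" "k < length e - Suc i - Suc j" "e ! (Suc i + (Suc j + k)) = c"
    by (auto simp: subseq_Cons_iff_nth add_ac)
  then show "\<exists>i j k. i < j \<and> j < k \<and> k < length e \<and> e ! i = a \<and> e ! j = b \<and> e ! k = c"
    by (intro exI[of _ i] exI[of _ "Suc i + j"] exI[of _ "Suc i + (Suc j + k)"]) auto
next
  assume "\<exists>i j k. i < j \<and> j < k \<and> k < length e \<and> e ! i = a \<and> e ! j = b \<and> e ! k = c"
  then obtain i j k where *: "i < j" "j < k" "k < length e" "e ! i = a" "e ! j = b" "e ! k = c"
    by blast
  have "subseq [c] (drop (Suc j) e)"
    unfolding subseq_Cons_iff_nth[of c] using * by (intro exI[of _ "k - Suc j"]) auto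
  then have "subseq [b, c] (drop (Suc i) e)"
    unfolding subseq_Cons_iff_nth[of b] using * by (intro exI[of _ "j - Suc i"]) auto
  then show "subseq [a, b, c] e"
    unfolding subseq_Cons_iff_nth[of a] using * by (intro exI[of _ i]) auto
qed

lemma length_3_conv: "length u = Suc (Suc (Suc 0)) \<longleftrightarrow> (\<exists>a b c. u = [a, b, c])"
  by (auto simp: length_Suc_conv)

lemma order_isomorphic_102:
  "order_isomorphic u [1, 0, 2] \<longleftrightarrow> (\<exists>a b c. u = [a, b, c] \<and> b < a \<and> a < c)"
proof -
  have "order_isomorphic [a, b, c] [1, 0, 2] \<longleftrightarrow> b < a \<and> a < c" for a b c
    by (simp add: order_isomorphic_def All_less_Suc2) linarith
  moreover have "\<exists>a b c. u = [a, b, c]" if "order_isomorphic u [1, 0, 2]"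
    using that by (simp add: order_isomorphic_def length_3_conv)
  ultimately show ?thesis by blast
qed

lemma order_isomorphic_021:
  "order_isomorphic u [0, 2, 1] \<longleftrightarrow> (\<exists>a b c. u = [a, b, c] \<and> a < c \<and> c < b)"
proof -
  have "order_isomorphic [a, b, c] [0, 2, 1] \<longleftrightarrow> a < c \<and> c < b" for a b c
    by (simp add: order_isomorphic_def All_less_Suc2) linarith
  moreover have "\<exists>a b c. u = [a, b, c]" if "order_isomorphic u [0, 2, 1]"
    using that by (simp add: order_isomorphic_def length_3_conv)
  ultimately show ?thesis by blast
qed

lemma contains_pattern_3_iff_nth:
  assumes "\<And>u. order_isomorphic u p \<longleftrightarrow> (\<exists>a b c. u = [a, b, c] \<and> P a b c)"
  shows "contains_pattern e p \<longleftrightarrow>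
    (\<exists>i j k. i < j \<and> j < k \<and> k < length e \<and> P (e ! i) (e ! j) (e ! k))"
proof -
  have "contains_pattern e p \<longleftrightarrow> (\<exists>a b c. subseq [a, b, c] e \<and> P a b c)"
    unfolding contains_pattern_def assms by blast
  also have "\<dots> \<longleftrightarrow> (\<exists>i j k. i < j \<and> j < k \<and> k < length e \<and> P (e ! i) (e ! j) (e ! k))"
    unfolding subseq_3_iff_nth by blast
  finally show ?thesis .
qed

lemma contains_102_iff:
  "contains_pattern e [1, 0, 2] \<longleftrightarrow>
    (\<exists>i j k. i < j \<and> j < k \<and> k < length e \<and> e ! j < e ! i \<and> e ! i < e ! k)"
  using contains_pattern_3_iff_nth[OF order_isomorphic_102] .

lemma contains_021_iff:
  "contains_pattern e [0, 2, 1] \<longleftrightarrow>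
    (\<exists>i j k. i < j \<and> j < k \<and> k < length e \<and> e ! i < e ! k \<and> e ! k < e ! j)"
  using contains_pattern_3_iff_nth[OF order_isomorphic_021] .

text \<open>Avoidance of \<open>102\<close> and \<open>021\<close> simultaneously, in terms of positions.\<close>

definition avoids_both :: "nat list \<Rightarrow> bool" where
  "avoids_both e \<longleftrightarrow>
    (\<forall>i j k. i < j \<longrightarrow> j < k \<longrightarrow> k < length e \<longrightarrow>
       \<not> (e ! j < e ! i \<and> e ! i < e ! k) \<and> \<not> (e ! i < e ! k \<and> e ! k < e ! j))"

text \<open>The avoiders with \<open>n\<close> letters.\<close>

definition avoiders :: "nat \<Rightarrow> nat list set" where
  "avoiders n = {e \<in> below_diagonal n. avoids_both e}"

lemma avoiding_inversion_sequences_eq: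
  "avoiding_inversion_sequences n {[1,0,2], [0,2,1]} = avoiders (Suc n)"
proof -
  have "(\<forall>p\<in>{[1,0,2], [0,2,1]}. \<not> contains_pattern e p) \<longleftrightarrow> avoids_both e" for e
    unfolding avoids_both_def ball_simps contains_102_iff contains_021_iff by blast
  then show ?thesis
    by (simp only: avoiding_inversion_sequences_def avoiders_def inversion_sequences_eq)
qed

lemma finite_avoiders: "finite (avoiders n)"
  by (simp add: avoiders_def finite_below_diagonal)

lemma avoids_bothD:
  assumes "avoids_both e" "i < j" "j < k" "k < length e"
  shows "\<not> (e ! j < e ! i \<and> e ! i < e ! k)" "\<not> (e ! i < e ! k \<and> e ! k < e ! j)"
  using assms unfolding avoids_both_def by blast+

lemma avoids_bothI:
  assumes "\<And>i j k. i < j \<Longrightarrow> j < k \<Longrightarrow> k < length e \<Longrightarrow>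
    \<not> (e ! j < e ! i \<and> e ! i < e ! k) \<and> \<not> (e ! i < e ! k \<and> e ! k < e ! j)"
  shows "avoids_both e"
  using assms unfolding avoids_both_def by blast

lemma avoids_both_snocD:
  assumes "avoids_both (e @ [y])"
  shows "avoids_both e"
proof (rule avoids_bothI)
  fix i j k assume "i < j" "j < k" "k < length e"
  then show "\<not> (e ! j < e ! i \<and> e ! i < e ! k) \<and> \<not> (e ! i < e ! k \<and> e ! k < e ! j)"
    using avoids_bothD[OF assms, of i j k] by (simp add: nth_append)
qed

lemma avoids_both_snoc_0:
  assumes "avoids_both e"
  shows "avoids_both (e @ [0])"
proof (rule avoids_bothI)
  fix i j k assume *: "i < j" "j < k" "k < length (e @ [0])"
  let ?f = "e @ [0]"
  show "\<not> (?f ! j < ?f ! i \<and> ?f ! i < ?f ! k) \<and> \<not> (?f ! i < ?f ! k \<and> ?f ! k < ?f ! j)"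
  proof (cases "k < length e")
    case True
    then show ?thesis using * avoids_bothD[OF assms, of i j k] by (simp add: nth_append)
  next
    case False
    then have "?f ! k = 0" using * by (simp add: nth_append)
    then show ?thesis by simp
  qed
qed

lemma avoids_both_sorted:
  assumes "sorted e"
  shows "avoids_both e"
proof (rule avoids_bothI)
  fix i j k assume "i < j" "j < k" "k < length e"
  then have "e ! i \<le> e ! j" "e ! j \<le> e ! k"
    using assms by (auto intro: sorted_nth_mono)
  then show "\<not> (e ! j < e ! i \<and> e ! i < e ! k) \<and> \<not> (e ! i < e ! k \<and> e ! k < e ! j)"
    by auto
qed

lemma avoids_both_two_valued:
  assumes "set e \<subseteq> {0, m}"
  shows "avoids_both e"
proof (rule avoids_bothI)
  fix i j k assume "i < j" "j < k" "k < length e"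
  then have "e ! i \<in> {0, m}" "e ! j \<in> {0, m}" "e ! k \<in> {0, m}"
    using assms by (meson less_trans nth_mem subsetD)+
  then show "\<not> (e ! j < e ! i \<and> e ! i < e ! k) \<and> \<not> (e ! i < e ! k \<and> e ! k < e ! j)"
    by auto
qed

text \<open>The structural core: which avoiders can be extended by a positive letter, and how.\<close>

lemma avoids_both_snoc_pos:
  assumes "e \<in> below_diagonal n" "n > 0" "avoids_both (e @ [y])" "y > 0"
  shows "sorted (e @ [y]) \<or> \<not> sorted e \<and> set e \<subseteq> {0, y}"
proof -
  have len: "length e = n" using assms by (auto simp: below_diagonal_def)
  have e0: "e ! 0 = 0" using assms below_diagonal_hd by blast
  have no102: "\<not> (e ! j < e ! i \<and> e ! i < y)" if "i < j" "j < n" for i j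
    using avoids_bothD(1)[OF assms(3), of i j n] that len by (simp add: nth_append)
  have no021: "\<not> (0 < e ! j \<and> e ! j < e ! i)" if "i < j" "j < n" for i j
  proof
    assume *: "0 < e ! j \<and> e ! j < e ! i"
    then have "0 < i" using e0 by (metis gr0I less_zeroE)
    with * that avoids_bothD(2)[OF avoids_both_snocD[OF assms(3)], of 0 i j] e0 len show False
      by simp
  qed
  have le: "x \<le> y" if x: "x \<in> set e" for x
  proof (rule ccontr)
    assume "\<not> x \<le> y"
    from x obtain i where i: "i < n" "e ! i = x" using len by (auto simp: in_set_conv_nth)
    with \<open>\<not> x \<le> y\<close> have "0 < i" using e0 by (metis gr0I le0)
    with i \<open>\<not> x \<le> y\<close> assms(4) e0 len avoids_bothD(2)[OF assms(3), of 0 i n] show False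
      by (simp add: nth_append)
  qed
  show ?thesis
  proof (cases "sorted e")
    case True
    then show ?thesis using le by (simp add: sorted_append)
  next
    case False
    then obtain i j where ij: "i < j" "j < n" "e ! j < e ! i"
      using len by (auto simp: sorted_iff_nth_mono_less not_le)
    \<comment> \<open>The descent from \<open>i\<close> to \<open>j\<close> must go from \<open>y\<close> to \<open>0\<close>; any other nonzero letter would
      complete a forbidden pattern with it.\<close>
    have ej: "e ! j = 0" using no021 ij by auto
    have ei: "e ! i = y" using no102[OF ij(1,2)] ij le[of "e ! i"] len by auto
    have "x = 0 \<or> x = y" if x: "x \<in> set e" for x
    proof (rule ccontr)
      assume nx: "\<not> (x = 0 \<or> x = y)"
      from x obtain l where l: "l < n" "e ! l = x" using len by (auto simp: in_set_conv_nth)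
      have xy: "0 < x" "x < y" using nx le[OF x] by auto
      have "l \<noteq> j" using ej l xy by auto
      then consider "l < j" | "j < l" by linarith
      then show False
      proof cases
        case 1
        then show False using no102[of l j] ij ej l xy by auto
      next
        case 2
        then show False using no021[of i l] ij ei l xy by auto
      qed
    qed
    then show ?thesis using False by auto
  qed
qed

lemma avoiders_Suc:
  assumes "n > 0"
  shows "avoiders (Suc n) = (\<lambda>e. e @ [0]) ` avoiders n \<union>
    ({e \<in> below_diagonal (Suc n). sorted e} - {replicate (Suc n) 0}) \<union>
    (\<lambda>e. e @ [Max (set e)]) ` unsorted_two_valued n"
    (is "_ = ?A \<union> ?B \<union> ?C")
proof (intro equalityI subsetI)
  fix f assume f: "f \<in> avoiders (Suc n)"
  then obtain e y where fe: "f = e @ [y]" "e \<in> below_diagonal n" "y \<le> n"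
    by (auto simp: avoiders_def elim: below_diagonal_SucE)
  have av: "avoids_both (e @ [y])" using f fe by (simp add: avoiders_def)
  show "f \<in> ?A \<union> ?B \<union> ?C"
  proof (cases "y = 0")
    case True
    then show ?thesis using fe avoids_both_snocD[OF av] by (auto simp: avoiders_def)
  next
    case False
    have nz: "f \<noteq> replicate (Suc n) 0"
      using fe False by (metis last_replicate last_snoc nat.distinct(1))
    consider "sorted f" | "\<not> sorted e" "set e \<subseteq> {0, y}"
      using avoids_both_snoc_pos[OF fe(2) assms av] False fe by auto
    then show ?thesis
    proof cases
      case 2
      then have "e \<in> unsorted_two_valued n" using fe by (auto simp: unsorted_two_valued_def)
      moreover have "Max (set e) = y"
        using two_valued_Max(1)[OF 2(2) unsorted_not_zeros[OF 2(1)]] .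
      ultimately show ?thesis using fe by blast
    qed (use f nz in \<open>auto simp: avoiders_def\<close>)
  qed
next
  fix f assume "f \<in> ?A \<union> ?B \<union> ?C"
  then consider "f \<in> ?A" | "f \<in> ?B" | "f \<in> ?C" by blast
  then show "f \<in> avoiders (Suc n)"
  proof cases
    case 1
    then show ?thesis
      by (auto simp: avoiders_def snoc_in_below_diagonal_iff avoids_both_snoc_0)
  next
    case 2
    then show ?thesis by (auto simp: avoiders_def avoids_both_sorted)
  next
    case 3
    then obtain e m where e: "f = e @ [Max (set e)]" "\<not> sorted e" "set e \<subseteq> {0, m}"
      "e \<in> below_diagonal n"
      by (auto simp: unsorted_two_valued_def)
    note M = two_valued_Max[OF e(3) unsorted_not_zeros[OF e(2)]]
    have "m < n" using below_diagonal_set_less e(4) M(3) by blast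
    moreover have "avoids_both f" using e M by (intro avoids_both_two_valued[of _ m]) auto
    ultimately show ?thesis using e M by (auto simp: avoiders_def snoc_in_below_diagonal_iff)
  qed
qed

lemma card_avoiders_Suc:
  assumes "n > 0"
  shows "real (card (avoiders (Suc n))) =
    real (card (avoiders n)) + catalan (Suc n) - 2 + 2 ^ n - real n * (real n + 1) / 2"
proof -
  let ?S = "{e \<in> below_diagonal (Suc n). sorted e}"
  let ?A = "(\<lambda>e. e @ [0]) ` avoiders n"
  let ?B = "?S - {replicate (Suc n) 0}"
  let ?C = "(\<lambda>e. e @ [Max (set e)]) ` unsorted_two_valued n"
  have fin: "finite ?A" "finite ?B" "finite ?C"
    by (auto simp: finite_avoiders finite_below_diagonal finite_unsorted_two_valued)
  have AB: "?A \<inter> ?B = {}"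
  proof -
    have "e @ [0] = replicate (Suc n) 0" if "e @ [0] \<in> ?S" for e
      using that by (subst eq_zeros_iff) (auto simp: sorted_append)
    then show ?thesis by blast
  qed
  have ABC: "(?A \<union> ?B) \<inter> ?C = {}"
  proof -
    have "e @ [Max (set e)] \<notin> ?A \<union> ?B" if e: "e \<in> unsorted_two_valued n" for e
    proof -
      from e obtain m where m: "set e \<subseteq> {0, m}" "\<not> sorted e" "\<not> set e \<subseteq> {0}"
        unfolding unsorted_two_valued_def using unsorted_not_zeros by blast
      from two_valued_Max[OF m(1,3)] have "Max (set e) \<noteq> 0" by simp
      then have "e @ [Max (set e)] \<notin> ?A" by blast
      moreover have "e @ [Max (set e)] \<notin> ?B" using m(2) by (simp add: sorted_append)
      ultimately show ?thesis by blast
    qed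
    then show ?thesis by (rule Int_image_empty)
  qed
  have "card (avoiders (Suc n)) = card ?A + card ?B + card ?C"
    unfolding avoiders_Suc[OF assms]
    using card_Un_disjoint[OF _ fin(3) ABC] card_Un_disjoint[OF fin(1,2) AB] fin by simp
  also have "card ?A = card (avoiders n)" by (simp add: card_image inj_on_snoc)
  also have "card ?C = card (unsorted_two_valued n)" by (simp add: card_image inj_on_snoc)
  finally have 1: "card (avoiders (Suc n)) =
    card (avoiders n) + card ?B + card (unsorted_two_valued n)" .
  have "replicate (Suc n) 0 \<in> ?S" using zeros_in_below_diagonal[of "Suc n"] by simp
  then have "card ?S = Suc (card ?B)"
    using finite_below_diagonal[of "Suc n"] by (intro card.remove) auto
  then have "real (card ?B) = catalan (Suc n) - 1"
    using card_sorted[of "Suc n"] by simp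
  with 1 show ?thesis using card_unsorted_two_valued[of n] by simp
qed

lemma card_avoiders:
  assumes "n \<ge> 1"
  shows "real (card (avoiders n)) =
    (\<Sum>k = 0..n. catalan k) - 1 - 1 / 6 * real n ^ 3 - 11 / 6 * real n + 2 ^ n"
  using assms
proof (induction n rule: dec_induct)
  case base
  have "avoiders 1 = {[0]}"
    by (auto simp: avoiders_def below_diagonal_def avoids_both_def length_Suc_conv)
  then show ?case by (simp add: catalan_def)
next
  case (step n)
  then show ?case
    by (simp add: card_avoiders_Suc field_simps power3_eq_cube)
qed

section \<open>Generating functions\<close>

text \<open>The generating function of the Catalan numbers.\<close>

definition catalan_fps :: "real fps" where
  "catalan_fps = Abs_fps catalan"

text \<open>The recurrence of the Catalan numbers, as the differential equation that
  \<open>sqrt (1 - 4 * x)\<close> satisfies.\<close>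

lemma catalan_fps_ODE:
  defines "F \<equiv> 1 - 2 * fps_X * catalan_fps"
  shows "fps_deriv F * (1 - 4 * fps_X) = - 2 * F"
proof (rule fps_ext)
  fix n
  have nth: "F $ k = (if k = 0 then 1 else - 2 * catalan (k - 1))" for k
    by (simp add: F_def catalan_fps_def mult.assoc numeral_fps_const)
  have "(fps_deriv F * (1 - 4 * fps_X)) $ n = fps_deriv F $ n - 4 * (fps_X * fps_deriv F) $ n"
    by (simp add: algebra_simps numeral_fps_const)
  also have "\<dots> = (- 2 * F) $ n"
  proof (cases n)
    case 0
    then show ?thesis by (simp add: nth numeral_fps_const catalan_def)
  next
    case (Suc m)
    have "(- 2 * F) $ n = - 2 * F $ n"
      by (simp add: numeral_fps_const)
    then show ?thesis using catalan_Suc[of m] 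
      by (simp add: nth Suc algebra_simps)
  qed
  finally show "(fps_deriv F * (1 - 4 * fps_X)) $ n = (- 2 * F) $ n" .
qed

lemma sqrt_1_minus_4x_eq: "sqrt_1_minus_4x = 1 - 2 * fps_X * catalan_fps"
proof -
  define F where "F = 1 - 2 * fps_X * catalan_fps"
  define G where "G = F ^ 2"
  have "fps_deriv G * (1 - 4 * fps_X) = 2 * F * (fps_deriv F * (1 - 4 * fps_X))"
    by (simp add: G_def power2_eq_square algebra_simps)
  also have "\<dots> = - 4 * G"
    using catalan_fps_ODE by (simp add: F_def[symmetric] G_def power2_eq_square)
  finally have ODE: "fps_deriv G * (1 - 4 * fps_X) = - 4 * G" .
  \<comment> \<open>This first-order equation determines \<open>G\<close> from its constant term, and \<open>1 - 4 * x\<close>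
    solves it as well.\<close>
  have rec: "real (Suc n) * G $ Suc n = 4 * (real n - 1) * G $ n" for n
  proof -
    have "(fps_deriv G * (1 - 4 * fps_X)) $ n = fps_deriv G $ n - 4 * (fps_X * fps_deriv G) $ n"
      by (simp add: algebra_simps numeral_fps_const)
    moreover have "(- 4 * G) $ n = - 4 * G $ n"
      by (simp add: numeral_fps_const)
    ultimately have "fps_deriv G $ n - 4 * (fps_X * fps_deriv G) $ n = - 4 * G $ n"
      unfolding ODE by linarith
    then show ?thesis
      by (cases n) (simp_all add: algebra_simps)
  qed
  have F0: "F $ 0 = 1" by (simp add: F_def mult.assoc numeral_fps_const)
  then have G0: "G $ 0 = 1" by (simp add: G_def power2_eq_square)
  have G1: "G $ 1 = - 4" using rec[of 0] G0 by simp
  have G2: "G $ Suc (Suc n) = 0" for n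
  proof (induction n)
    case 0
    show ?case using rec[of 1] by simp
  next
    case (Suc n)
    then have "real (Suc (Suc (Suc n))) * G $ Suc (Suc (Suc n)) = 0"
      using rec[of "Suc (Suc n)"] by simp
    then show ?case by (simp del: of_nat_Suc)
  qed
  have "G = 1 - 4 * fps_X"
  proof (rule fps_ext)
    fix n show "G $ n = (1 - 4 * fps_X) $ n"
      using G0 G1 G2 by (cases n; cases "n - 1") (auto simp: numeral_fps_const)
  qed
  then have "F ^ Suc 1 = 1 - 4 * fps_X" by (simp add: G_def numeral_2_eq_2)
  then have "F = fps_radical root (Suc 1) (1 - 4 * fps_X)"
    using F0 by (subst radical_unique[symmetric]) (auto simp: numeral_fps_const)
  then show ?thesis by (simp add: sqrt_1_minus_4x_def F_def numeral_2_eq_2)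
qed

lemma rational_part:
  defines "Q \<equiv> Abs_fps (\<lambda>n. - 1 - 1 / 6 * real n ^ 3 - 11 / 6 * real n + 2 ^ n) - 1"
  shows "((2 * fps_X ^ 2 - 2 * fps_X + 1) * (fps_X ^ 3 - 2 * fps_X ^ 2 + 3 * fps_X - 1))
             / ((1 - fps_X) ^ 4 * (1 - 2 * fps_X)) = Q"
  (is "?N / ?D = Q")
proof -
  have D: "?D = 1 - fps_const 6 * fps_X + fps_const 14 * fps_X ^ 2 - fps_const 16 * fps_X ^ 3
     + fps_const 9 * fps_X ^ 4 - fps_const 2 * (fps_X ^ 5 :: real fps)"
    unfolding numeral_fps_const[symmetric] by algebra
  have N: "?N = - 1 + fps_const 5 * fps_X - fps_const 10 * fps_X ^ 2 + fps_const 11 * fps_X ^ 3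
     - fps_const 6 * fps_X ^ 4 + fps_const 2 * (fps_X ^ 5 :: real fps)"
    unfolding numeral_fps_const[symmetric] by algebra
  have "Q * ?D = ?N"
  proof (rule fps_ext)
    fix n
    have QD: "(Q * ?D) $ n = Q $ n - 6 * (fps_X * Q) $ n + 14 * (fps_X ^ 2 * Q) $ n
      - 16 * (fps_X ^ 3 * Q) $ n + 9 * (fps_X ^ 4 * Q) $ n - 2 * (fps_X ^ 5 * Q) $ n"
    proof -
      have "Q * ?D = Q - fps_const 6 * (fps_X * Q) + fps_const 14 * (fps_X ^ 2 * Q)
        - fps_const 16 * (fps_X ^ 3 * Q) + fps_const 9 * (fps_X ^ 4 * Q) - fps_const 2 * (fps_X ^ 5 * Q)"
        unfolding D by (simp add: algebra_simps)
      then show ?thesis by simp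
    qed
    \<comment> \<open>The bound is \<open>6\<close> and not \<open>5\<close>, because the denominator has degree 5 and the
      constant term of \<open>Q\<close> does not follow its general formula.\<close>
    show "(Q * ?D) $ n = ?N $ n"
    proof (cases "n < 6")
      case True
      then consider "n = 0" | "n = 1" | "n = 2" | "n = 3" | "n = 4" | "n = 5" by linarith
      then show ?thesis
        unfolding QD N by cases (simp_all add: Q_def fps_X_power_mult_nth)
    next
      case False
      then obtain m where n: "n = m + 6" by (metis add.commute le_Suc_ex not_less)
      show ?thesis
        unfolding QD N
        by (simp add: Q_def n fps_X_power_mult_nth power_add field_simps power3_eq_cube)
    qed
  qed
  moreover have "?D \<noteq> 0"
  proof
    assume "?D = 0"
    then have "?D $ 0 = 0" by simp
    then show False unfolding D by simp
  qed
  ultimately show ?thesis by (metis nonzero_mult_div_cancel_right)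
qed

lemma catalan_part:
  "(1 - sqrt_1_minus_4x) / (2 * fps_X * (1 - fps_X)) = Abs_fps (\<lambda>n. \<Sum>k = 0..n. catalan k)"
  (is "_ = ?S")
proof -
  have "?S * (1 - fps_X) = catalan_fps"
  proof (rule fps_ext)
    fix n
    have "(?S * (1 - fps_X)) $ n = ?S $ n - (fps_X * ?S) $ n"
      by (simp add: algebra_simps)
    then show "(?S * (1 - fps_X)) $ n = catalan_fps $ n"
      by (cases n) (simp_all add: catalan_fps_def)
  qed
  then have "1 - sqrt_1_minus_4x = 2 * fps_X * (?S * (1 - fps_X))"
    by (simp add: sqrt_1_minus_4x_eq)
  then have "1 - sqrt_1_minus_4x = ?S * (2 * fps_X * (1 - fps_X))"
    by (simp only: mult_ac)
  moreover have "2 * fps_X * (1 - fps_X) \<noteq> (0 :: real fps)"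
  proof -
    have "(1 - fps_X :: real fps) $ 0 \<noteq> 0" by simp
    then have "(1 - fps_X :: real fps) \<noteq> 0" by (metis fps_zero_nth)
    then show ?thesis by simp
  qed
  ultimately show ?thesis by simp
qed

theorem theorem4p4:
  shows "R = (1 - sqrt_1_minus_4x) / (2 * fps_X * (1 - fps_X))
           + ((2 * fps_X ^ 2 - 2 * fps_X + 1) * (fps_X ^ 3 - 2 * fps_X ^ 2 + 3 * fps_X - 1))
             / ((1 - fps_X) ^ 4 * (1 - 2 * fps_X))
       \<and> (\<forall>n::nat. n \<ge> 1 \<longrightarrow>
           real (card (avoiding_inversion_sequences (n - 1) {[1,0,2], [0,2,1]}))
           = (\<Sum>k = 0..n. 1 / (real k + 1) * real ((2 * k) choose k))
             - 1 - 1 / 6 * real n ^ 3 - 11 / 6 * real n + 2 ^ n)"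
proof (intro conjI allI impI)
  fix n :: nat assume "n \<ge> 1"
  then have eq: "avoiding_inversion_sequences (n - 1) {[1,0,2], [0,2,1]} = avoiders n"
    unfolding avoiding_inversion_sequences_eq by simp
  show "real (card (avoiding_inversion_sequences (n - 1) {[1,0,2], [0,2,1]}))
           = (\<Sum>k = 0..n. 1 / (real k + 1) * real ((2 * k) choose k))
             - 1 - 1 / 6 * real n ^ 3 - 11 / 6 * real n + 2 ^ n"
    unfolding eq using card_avoiders[OF \<open>n \<ge> 1\<close>] by (simp only: catalan_def)
next
  show "R = (1 - sqrt_1_minus_4x) / (2 * fps_X * (1 - fps_X))
           + ((2 * fps_X ^ 2 - 2 * fps_X + 1) * (fps_X ^ 3 - 2 * fps_X ^ 2 + 3 * fps_X - 1))
             / ((1 - fps_X) ^ 4 * (1 - 2 * fps_X))"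
    unfolding catalan_part rational_part
  proof (rule fps_ext)
    fix n
    show "R $ n = (Abs_fps (\<lambda>n. \<Sum>k = 0..n. catalan k) +
      (Abs_fps (\<lambda>n. - 1 - 1 / 6 * real n ^ 3 - 11 / 6 * real n + 2 ^ n) - 1)) $ n"
    proof (cases n)
      case 0
      then show ?thesis by (simp add: R_def catalan_def)
    next
      case (Suc m)
      then show ?thesis
        using card_avoiders[of n]
        unfolding R_def avoiding_inversion_sequences_eq by (simp del: sum.atLeast0_atMost_Suc)
    qed
  qed
qed

end
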